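(* Let $R>0$, let $G\in\mathbb{R}^2$ with $G\neq O$, and let $q>0$. Let $I\subseteq S^1$ be any interval of directions on which $q+G\cdot u>0$; equivalently, for each $u\in I$ the tangent line to the circle $C(G,q)$ at $G+qu$ lies on the $u$-side of $O$ (that is, its signed distance from $O$ in the direction $u$ is positive) and its pole with respect to $\Sigma_R$ lies on the positive ray $\mathbb{R}_{>0}u$. Then, using the same direction parameter $u$, $$f_R\bigl(P_q(u)\bigr)=P_{q+R}(u)\qquad\text{for all }u\in I.$$ Equivalently, $$f_R\Bigl(\mathcal{R}_{\Sigma_R}(C(G,q))\big|_I\Bigr)=\mathcal{R}_{\Sigma_R}(C(G,q+R))\big|_I .$$ Thus, in terms of reciprocal circles, the center $G$ stays fixed and the radius is translated by exactly $R$: $q\mapsto q+R$.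
   Context: $O$ is the origin of $\mathbb{R}^2$, $\|\cdot\|$ is the Euclidean norm, and $S^1=\{u\in\mathbb{R}^2:\|u\|=1\}$. An interval of directions is a connected arc of $S^1$, possibly $S^1$ itself. For $R>0$, the radial cone projection of the plane onto the open disk $D_R=\{x\in\mathbb{R}^2:\|x\|<R\}$ is $$f_R(x)=\frac{x}{1+\|x\|/R}.$$ Put $\Sigma_R=\partial D_R=\{x:\|x\|=R\}$. The pole with respect to $\Sigma_R$ of a line $a\cdot x=c$ with $\|a\|=1$, $c\neq 0$, is the point $(R^2/c)\,a$. The reciprocal polar $\mathcal{R}_{\Sigma_R}(\Gamma)$ of a smooth curve $\Gamma$ is the locus of the poles with respect to $\Sigma_R$ of its tangent lines (a tangent through $O$ has no finite pole). For $G\neq O$ and $q>0$, let $C(G,q)=\{G+qu:u\in S^1\}$ be the circle with center $G$ and radius $q$. Its tangent line at $G+qu$ is $u\cdot x=q+G\cdot u$, where $q+G\cdot u$ is the signed distance from $O$ to this tangent in the direction $u$, and the pole of this tangent with respect to $\Sigma_R$ is $$P_q(u)=\frac{R^2}{q+G\cdot u}\,u .$$ The center $G$ is fixed in the notation $P_q$; $P_{q+R}(u)$ is the same expression with $q$ replaced by $q+R$. For an interval of directions $I$, write $\mathcal{R}_{\Sigma_R}(C(G,q))\big|_I:=\{P_q(u):u\in I\}$ for the corresponding sub-arc of the reciprocal polar. *)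

theory Defs
  imports "HOL-Analysis.Analysis"
begin

text \<open>The origin \<open>O\<close> is \<open>0 :: real^2\<close>, the circle \<open>S\<^sup>1\<close> is \<open>sphere 0 1\<close>, the circle \<open>C(G,q)\<close> is
  \<open>sphere G q\<close>, and \<open>\<Sigma>\<^sub>R\<close> is \<open>sphere 0 R\<close>, which enters only through its radius \<open>R\<close>.\<close>

text \<open>Open, closed and half-open arcs are all allowed, and so are the degenerate connected sets
  (a single direction, the empty set) and \<open>S\<^sup>1\<close> itself.\<close>

definition direction_interval :: "(real^2) set \<Rightarrow> bool" where
  "direction_interval I \<longleftrightarrow> I \<subseteq> sphere 0 1 \<and> connected I"

definition radial_proj :: "real \<Rightarrow> real^2 \<Rightarrow> real^2" where
  "radial_proj R x = (1 / (1 + norm x / R)) *\<^sub>R x"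

definition line_with_normal :: "real^2 \<Rightarrow> real \<Rightarrow> (real^2) set" where
  "line_with_normal a c = {x. a \<bullet> x = c}"

text \<open>A relation rather than a function, since a line through the origin has no pole. The two
  normal forms \<open>(a, c)\<close> and \<open>(-a, -c)\<close> of a line give the same point.\<close>

definition is_pole_of :: "real \<Rightarrow> (real^2) set \<Rightarrow> real^2 \<Rightarrow> bool" where
  "is_pole_of R L p \<longleftrightarrow>
     (\<exists>a c. norm a = 1 \<and> c \<noteq> 0 \<and> L = line_with_normal a c \<and> p = (R\<^sup>2 / c) *\<^sub>R a)"

text \<open>\<open>L\<close> is spanned by the nonzero velocity of a path that runs in \<open>\<Gamma>\<close> and passes through \<open>x\<close>
  at time 0. Intended for point sets \<open>\<Gamma>\<close> that are smooth curves.\<close>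

definition is_tangent_line :: "(real^2) set \<Rightarrow> real^2 \<Rightarrow> (real^2) set \<Rightarrow> bool" where
  "is_tangent_line \<Gamma> x L \<longleftrightarrow>
     (\<exists>\<gamma> v. \<gamma> 0 = x \<and> (\<forall>\<^sub>F t in nhds (0::real). \<gamma> t \<in> \<Gamma>) \<and>
            (\<gamma> has_vector_derivative v) (at 0) \<and> v \<noteq> 0 \<and>
            L = range (\<lambda>s::real. x + s *\<^sub>R v))"

definition reciprocal_polar :: "real \<Rightarrow> (real^2) set \<Rightarrow> (real^2) set" where
  "reciprocal_polar R \<Gamma> = {p. \<exists>x L. is_tangent_line \<Gamma> x L \<and> is_pole_of R L p}"

text \<open>\<open>d\<close> is the signed distance from the origin to \<open>L\<close> in the unit direction \<open>u\<close>; it exists only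
  if \<open>u\<close> is normal to \<open>L\<close>.\<close>

definition is_signed_distance :: "real^2 \<Rightarrow> (real^2) set \<Rightarrow> real \<Rightarrow> bool" where
  "is_signed_distance u L d \<longleftrightarrow> L = line_with_normal u d"

definition positive_ray :: "real^2 \<Rightarrow> (real^2) set" where
  "positive_ray u = {t *\<^sub>R u | t. t > 0}"

text \<open>\<open>P\<^sub>q(u)\<close>, with \<open>R\<close> and \<open>G\<close> explicit; meaningful where \<open>q + G \<bullet> u \<noteq> 0\<close>.\<close>

definition polar_point :: "real \<Rightarrow> real^2 \<Rightarrow> real \<Rightarrow> real^2 \<Rightarrow> real^2" where
  "polar_point R G q u = (R\<^sup>2 / (q + G \<bullet> u)) *\<^sub>R u"

text \<open>The sub-arc over \<open>I\<close> of the reciprocal polar of \<open>C(G,q)\<close>; that it is part of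
  \<open>reciprocal_polar R (sphere G q)\<close> is shown below.\<close>

definition reciprocal_polar_arc :: "real \<Rightarrow> real^2 \<Rightarrow> real \<Rightarrow> (real^2) set \<Rightarrow> (real^2) set" where
  "reciprocal_polar_arc R G q I = {polar_point R G q u | u. u \<in> I}"

lemma orthogonal_line_eq:
  fixes u v x :: "real^2"
  assumes "v \<noteq> 0" "u \<noteq> 0" "u \<bullet> v = 0"
  shows "range (\<lambda>s::real. x + s *\<^sub>R v) = line_with_normal u (u \<bullet> x)"
proof (intro equalityI subsetI)
  fix y assume "y \<in> range (\<lambda>s::real. x + s *\<^sub>R v)"
  then show "y \<in> line_with_normal u (u \<bullet> x)"
    using assms by (auto simp: line_with_normal_def inner_add_right)
next
  fix y assume "y \<in> line_with_normal u (u \<bullet> x)"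
  then have w: "u \<bullet> (y - x) = 0"
    by (simp add: line_with_normal_def inner_diff_right)
  define w where "w = y - x"
  have e1: "u$1 * w$1 + u$2 * w$2 = 0"
    using w by (simp add: w_def inner_vec_def sum_2)
  have e2: "u$1 * v$1 + u$2 * v$2 = 0"
    using assms(3) by (simp add: inner_vec_def sum_2)
  have une: "u$1 \<noteq> 0 \<or> u$2 \<noteq> 0"
    using assms(2) by (metis (mono_tags) exhaust_2 vec_eq_iff zero_index)
  have vne: "v$1 \<noteq> 0 \<or> v$2 \<noteq> 0"
    using assms(1) by (metis (mono_tags) exhaust_2 vec_eq_iff zero_index)
  have "u$1 * (v$1 * w$2 - v$2 * w$1) = 0" "u$2 * (v$1 * w$2 - v$2 * w$1) = 0"
    using e1 e2 by algebra+
  then have cross: "v$1 * w$2 = v$2 * w$1"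
    using une by auto
  have "\<exists>s. w$1 = s * v$1 \<and> w$2 = s * v$2"
  proof (cases "v$1 = 0")
    case True
    then show ?thesis using cross vne by (intro exI[of _ "w$2 / v$2"]) auto
  next
    case False
    then show ?thesis using cross by (intro exI[of _ "w$1 / v$1"]) (auto simp: field_simps)
  qed
  then obtain s where "w$1 = s * v$1" "w$2 = s * v$2" by blast
  then have "w = s *\<^sub>R v" by (simp add: vec_eq_iff forall_2)
  then have "y = x + s *\<^sub>R v" by (simp add: w_def algebra_simps)
  then show "y \<in> range (\<lambda>s::real. x + s *\<^sub>R v)" by blast
qed

lemma circle_tangent_line_iff:
  fixes G u :: "real^2"
  assumes q: "q > 0" and u: "norm u = 1"
  shows "is_tangent_line (sphere G q) (G + q *\<^sub>R u) L \<longleftrightarrow> L = line_with_normal u (q + G \<bullet> u)"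
proof -
  have uu: "u \<bullet> u = 1" using u by (simp add: norm_eq_1)
  have c: "u \<bullet> (G + q *\<^sub>R u) = q + G \<bullet> u"
    by (simp add: inner_add_right uu inner_commute)
  have une: "u \<noteq> 0" using u by auto
  show ?thesis
  proof
    assume "is_tangent_line (sphere G q) (G + q *\<^sub>R u) L"
    then obtain g v where g0: "g 0 = G + q *\<^sub>R u"
      and ev: "\<forall>\<^sub>F t in nhds (0::real). g t \<in> sphere G q"
      and dg: "(g has_vector_derivative v) (at 0)" and v: "v \<noteq> 0"
      and L: "L = range (\<lambda>s::real. (G + q *\<^sub>R u) + s *\<^sub>R v)"
      unfolding is_tangent_line_def by blast
    have d1: "((\<lambda>t. (g t - G) \<bullet> (g t - G)) has_derivative
        (\<lambda>h. (g 0 - G) \<bullet> (h *\<^sub>R v) + (h *\<^sub>R v) \<bullet> (g 0 - G))) (at 0)"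
      using dg unfolding has_vector_derivative_def
      by (auto intro!: derivative_eq_intros)
    have evc: "\<forall>\<^sub>F t in nhds (0::real). (g t - G) \<bullet> (g t - G) = q\<^sup>2"
      using ev by eventually_elim
        (simp add: dist_norm norm_minus_commute dot_square_norm)
    have d2: "((\<lambda>t. (g t - G) \<bullet> (g t - G)) has_derivative (\<lambda>h. 0)) (at 0)"
    proof (rule has_derivative_transform_eventually[of "\<lambda>_. q\<^sup>2"])
      show "\<forall>\<^sub>F t in at 0. q\<^sup>2 = (g t - G) \<bullet> (g t - G)"
        using evc by (auto simp: eventually_at_filter elim: eventually_mono)
      show "q\<^sup>2 = (g 0 - G) \<bullet> (g 0 - G)"
        using eventually_nhds_x_imp_x[OF evc] by simp
    qed auto
    have "(\<lambda>h. (g 0 - G) \<bullet> (h *\<^sub>R v) + (h *\<^sub>R v) \<bullet> (g 0 - G)) = (\<lambda>h. 0)"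
      using has_derivative_unique[OF d1 d2] .
    from fun_cong[OF this, of 1] have "u \<bullet> v = 0"
      using q by (simp add: g0 inner_commute)
    from orthogonal_line_eq[OF v une this]
    show "L = line_with_normal u (q + G \<bullet> u)"
      unfolding L c[symmetric] .
  next
    assume L: "L = line_with_normal u (q + G \<bullet> u)"
    define w :: "real^2" where "w = vector [- u$2, u$1]"
    have uw: "u \<bullet> w = 0" by (simp add: w_def inner_vec_def sum_2)
    have ww: "w \<bullet> w = 1"
      using uu by (simp add: w_def inner_vec_def sum_2)
    have wne: "w \<noteq> 0" using ww by auto
    define g where "g = (\<lambda>t::real. G + q *\<^sub>R (cos t *\<^sub>R u + sin t *\<^sub>R w))"
    have "norm (cos t *\<^sub>R u + sin t *\<^sub>R w) = 1" for t
      using sin_cos_squared_add2[of t]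
      by (simp add: norm_eq_1 inner_add inner_commute[of w u] uu ww uw power2_eq_square)
    then have on: "g t \<in> sphere G q" for t
      using q by (simp add: g_def dist_norm)
    have d: "(g has_vector_derivative q *\<^sub>R w) (at 0)"
      unfolding g_def has_vector_derivative_def
      by (auto intro!: derivative_eq_intros)
    have "L = range (\<lambda>s::real. (G + q *\<^sub>R u) + s *\<^sub>R (q *\<^sub>R w))"
      using orthogonal_line_eq[of "q *\<^sub>R w" u "G + q *\<^sub>R u"] q wne une uw
      by (simp add: L c)
    moreover have "g 0 = G + q *\<^sub>R u" by (simp add: g_def)
    ultimately show "is_tangent_line (sphere G q) (G + q *\<^sub>R u) L"
      unfolding is_tangent_line_def using on d q wne
      by (intro exI[of _ g] exI[of _ "q *\<^sub>R w"]) auto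
  qed
qed

lemma line_with_normal_unique:
  assumes "norm a = 1" "norm b = 1" "c \<noteq> 0" and eq: "line_with_normal a c = line_with_normal b d"
  shows "d \<noteq> 0" "(r / c) *\<^sub>R a = (r / d) *\<^sub>R b"
proof -
  have aa: "a \<bullet> a = 1" and bb: "b \<bullet> b = 1" using assms by (simp_all add: norm_eq_1)
  have "c *\<^sub>R a \<in> line_with_normal b d"
    unfolding eq[symmetric] by (simp add: line_with_normal_def aa)
  then have e1: "c * (b \<bullet> a) = d" by (simp add: line_with_normal_def)
  have "d *\<^sub>R b \<in> line_with_normal a c"
    unfolding eq by (simp add: line_with_normal_def bb)
  then have e2: "d * (a \<bullet> b) = c" by (simp add: line_with_normal_def)
  show d: "d \<noteq> 0" using e2 \<open>c \<noteq> 0\<close> by auto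
  define k where "k = a \<bullet> b"
  have ck: "c * k = d" "d * k = c" using e1 e2 by (simp_all add: k_def inner_commute)
  then have "c * (k * k) = c * 1" by (simp add: mult.assoc[symmetric])
  then have kk: "k * k = 1" using \<open>c \<noteq> 0\<close> by simp
  have "(a - k *\<^sub>R b) \<bullet> (a - k *\<^sub>R b) = 1 - k * k"
    by (simp add: inner_diff aa bb k_def inner_commute[of b a])
  then have "a = k *\<^sub>R b" using kk by simp
  then show "(r / c) *\<^sub>R a = (r / d) *\<^sub>R b"
    using ck kk d \<open>c \<noteq> 0\<close> by (auto simp: field_simps)
qed

lemma is_pole_of_line_with_normal_iff:
  assumes "norm a = 1"
  shows "is_pole_of R (line_with_normal a c) p \<longleftrightarrow> c \<noteq> 0 \<and> p = (R\<^sup>2 / c) *\<^sub>R a"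
  unfolding is_pole_of_def using assms line_with_normal_unique by metis

lemma reciprocal_polar_circle:
  fixes G :: "real^2"
  assumes q: "q > 0"
  shows "reciprocal_polar R (sphere G q) = reciprocal_polar_arc R G q {u \<in> sphere 0 1. q + G \<bullet> u \<noteq> 0}"
proof (intro equalityI subsetI)
  fix p assume "p \<in> reciprocal_polar R (sphere G q)"
  then obtain x L where t: "is_tangent_line (sphere G q) x L" and p: "is_pole_of R L p"
    unfolding reciprocal_polar_def by blast
  have "x \<in> sphere G q"
    using t unfolding is_tangent_line_def by (metis eventually_nhds_x_imp_x)
  define u where "u = (1 / q) *\<^sub>R (x - G)"
  have u: "norm u = 1" and x: "x = G + q *\<^sub>R u"
    using \<open>x \<in> sphere G q\<close> q by (simp_all add: u_def dist_norm norm_minus_commute)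
  have L: "L = line_with_normal u (q + G \<bullet> u)"
    using t circle_tangent_line_iff[OF q u] x by simp
  show "p \<in> reciprocal_polar_arc R G q {u \<in> sphere 0 1. q + G \<bullet> u \<noteq> 0}"
    using p u is_pole_of_line_with_normal_iff[OF u]
    by (auto simp: L reciprocal_polar_arc_def polar_point_def)
next
  fix p assume "p \<in> reciprocal_polar_arc R G q {u \<in> sphere 0 1. q + G \<bullet> u \<noteq> 0}"
  then obtain u where u: "norm u = 1" "q + G \<bullet> u \<noteq> 0" "p = polar_point R G q u"
    by (auto simp: reciprocal_polar_arc_def)
  then show "p \<in> reciprocal_polar R (sphere G q)"
    unfolding reciprocal_polar_def polar_point_def
    using circle_tangent_line_iff[OF q u(1)] is_pole_of_line_with_normal_iff[OF u(1)] by blast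
qed

end

theory Submission
  imports Defs
begin

text \<open>Both poles lie on the ray of \<open>u\<close>, so only their distances from the origin matter. A point at
  distance \<open>r\<close> is moved by \<open>f\<^sub>R\<close> to distance \<open>r / (1 + r / R)\<close>, whose reciprocal is
  \<open>1 / r + 1 / R\<close>: the projection is the translation by \<open>1 / R\<close> of the reciprocal distance. The pole
  of a tangent at distance \<open>h\<close> from the origin has reciprocal distance \<open>h / R\<^sup>2\<close>, so the projection
  adds \<open>R\<close> to \<open>h\<close> (lemma \<open>radial_proj_pole\<close>). For the circle, \<open>h = q + G \<bullet> u\<close>, and adding \<open>R\<close> to
  \<open>h\<close> for every \<open>u\<close> is adding \<open>R\<close> to the radius.

  The geometric reading of \<open>q + G \<bullet> u > 0\<close> (lemma \<open>positive_support_iff_tangent_pole\<close>) holds because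
  the circle has only one tangent line at \<open>G + q u\<close>, and this line has only one signed distance in the
  direction \<open>u\<close>, namely \<open>q + G \<bullet> u\<close>.\<close>

lemma radial_proj_pole:
  fixes u :: "real^2"
  assumes "R > 0" "h > 0" "norm u = 1"
  shows "radial_proj R ((R\<^sup>2 / h) *\<^sub>R u) = (R\<^sup>2 / (h + R)) *\<^sub>R u"
proof -
  have "norm ((R\<^sup>2 / h) *\<^sub>R u) / R = R / h"
    using assms by (simp add: power2_eq_square)
  moreover have "1 / (1 + R / h) * (R\<^sup>2 / h) = R\<^sup>2 / (h + R)"
    using assms by (simp add: divide_simps)
  ultimately show ?thesis
    by (simp add: radial_proj_def)
qed

text \<open>The foot \<open>d u\<close> of the perpendicular from the origin lies on the line and determines \<open>d\<close>.\<close>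

lemma is_signed_distance_line_with_normal_iff:
  assumes "norm u = 1"
  shows "is_signed_distance u (line_with_normal u c) d \<longleftrightarrow> d = c"
proof
  assume "is_signed_distance u (line_with_normal u c) d"
  moreover have "d *\<^sub>R u \<in> line_with_normal u d"
    using assms by (simp add: line_with_normal_def norm_eq_1)
  ultimately have "d *\<^sub>R u \<in> line_with_normal u c"
    by (simp add: is_signed_distance_def)
  then show "d = c"
    using assms by (simp add: line_with_normal_def norm_eq_1)
qed (simp add: is_signed_distance_def)

lemma positive_support_iff_tangent_pole:
  fixes G u :: "real^2"
  assumes "R > 0" "q > 0" and u: "norm u = 1"
  shows "q + G \<bullet> u > 0 \<longleftrightarrow>
    (\<exists>L d p. is_tangent_line (sphere G q) (G + q *\<^sub>R u) L \<and>
       is_signed_distance u L d \<and> d > 0 \<and> is_pole_of R L p \<and> p \<in> positive_ray u)"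
proof -
  have "(R\<^sup>2 / h) *\<^sub>R u \<in> positive_ray u" if "h > 0" for h
    unfolding positive_ray_def using that \<open>R > 0\<close> by fastforce
  then show ?thesis
    by (auto simp: circle_tangent_line_iff[OF \<open>q > 0\<close> u]
        is_signed_distance_line_with_normal_iff[OF u] is_pole_of_line_with_normal_iff[OF u])
qed

lemma radial_proj_polar_point:
  assumes "R > 0" "q + G \<bullet> u > 0" "norm u = 1"
  shows "radial_proj R (polar_point R G q u) = polar_point R G (q + R) u"
  using radial_proj_pole[OF assms] by (simp add: polar_point_def add_ac)

theorem theorem2p2:
  fixes R q :: real and G :: "real^2" and I :: "(real^2) set"
  assumes "R > 0" and "G \<noteq> 0" and "q > 0" and "direction_interval I"
  shows "((\<forall>u\<in>I. q + G \<bullet> u > 0) \<longleftrightarrow>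
            (\<forall>u\<in>I. \<exists>L d p. is_tangent_line (sphere G q) (G + q *\<^sub>R u) L \<and>
                is_signed_distance u L d \<and> d > 0 \<and>
                is_pole_of R L p \<and> p \<in> positive_ray u)) \<and>
         ((\<forall>u\<in>I. q + G \<bullet> u > 0) \<longrightarrow>
            (\<forall>u\<in>I. radial_proj R (polar_point R G q u) = polar_point R G (q + R) u) \<and>
            radial_proj R ` reciprocal_polar_arc R G q I = reciprocal_polar_arc R G (q + R) I)"
proof -
  have unit: "norm u = 1" if "u \<in> I" for u
    using assms(4) that by (auto simp: direction_interval_def)
  have "radial_proj R ` reciprocal_polar_arc R G q I = reciprocal_polar_arc R G (q + R) I"
    if "\<forall>u\<in>I. radial_proj R (polar_point R G q u) = polar_point R G (q + R) u"
    using that unfolding reciprocal_polar_arc_def Setcompr_eq_image image_image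
    by (intro image_cong) auto
  moreover have "\<forall>u\<in>I. radial_proj R (polar_point R G q u) = polar_point R G (q + R) u"
    if "\<forall>u\<in>I. q + G \<bullet> u > 0"
    using radial_proj_polar_point[OF assms(1)] that unit by blast
  ultimately show ?thesis
    using positive_support_iff_tangent_pole[OF assms(1,3) unit] by simp
qed

end
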